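(* Let $\Omega\subset\mathbb{R}^n$ be open and bounded and let $g_i\in BC(\mathbb{B}^d)$, $i\in\mathbb{N}$, with $\|g_i\|_\infty\le1$. Let $F=C(\overline\Omega)\cup C(\overline{\mathbb{B}^d})\cup\{g_i:i\in\mathbb{N}\}$, viewed as a family of functions on $\Omega\times\mathbb{B}^d$. Then $C(e_F(\Omega\times\mathbb{B}^d))$ is isometrically isomorphic to $C\big(\overline\Omega\times\overline{\mathrm{graph}(g_i)}\big)$, where $(g_i):\mathbb{B}^d\to[-1,1]^{\mathbb{N}}$, $z\mapsto(g_i(z))_{i\in\mathbb{N}}$, and $[-1,1]^{\mathbb{N}}$ carries the product topology. Moreover, the topology of $\overline{\mathrm{graph}(g_i)}$ is metrised by (the continuous extension to the closure of) $$d(z,w)=|z-w|+\sum_i2^{-i}|g_i(z)-g_i(w)|,\qquad z,w\in\mathbb{B}^d .$$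
   Context: $\mathbb{B}^d$ is the open unit ball of $\mathbb{R}^d$; $BC$ denotes bounded continuous real functions; all $C(\cdot)$ spaces carry the sup norm. Functions of $x\in\Omega$ only or of $z\in\mathbb{B}^d$ only are regarded as functions on $\Omega\times\mathbb{B}^d$ constant in the other variable; functions on $\overline\Omega$, $\overline{\mathbb{B}^d}$ are restricted to $\Omega$, $\mathbb{B}^d$. For a family $F\subset BC(X)$, $e_FX$ is the closure of the image of $X$ under $x\mapsto(f(x))_{f\in F}\in\prod_{f\in F}[\inf f,\sup f]$ (product topology). $\mathrm{graph}(g_i)=\{(z,(g_i(z))_{i\in\mathbb{N}}):z\in\mathbb{B}^d\}$ and its closure is taken in $\overline{\mathbb{B}^d}\times[-1,1]^{\mathbb{N}}$; a point $z\in\mathbb{B}^d$ is identified with $(z,(g_i(z))_i)$, so the extended metric is $|z-w|+\sum_i2^{-i}|a_i-b_i|$ for points $(z,(a_i))$, $(w,(b_i))$ of the closure. *)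

theory Defs
  imports "HOL-Analysis.Analysis"
begin

text \<open>
  The real Banach space of bounded continuous functions on \<open>X\<close>. Its elements are represented by
  functions that are extensional on \<open>topspace X\<close>, and its metric is the sup distance. For a compact
  space \<open>X\<close> it consists of all continuous functions, see \<open>mspace_BC_compact\<close>.
\<close>

abbreviation BC :: "'a topology \<Rightarrow> ('a \<Rightarrow> real) metric"
  where "BC X \<equiv> cfunspace X euclidean_metric"

lemma mspace_BC_compact:
  assumes "compact_space X"
  shows "mspace (BC X) = {f \<in> extensional (topspace X). continuous_map X euclideanreal f}"
proof -
  have "bounded (f ` topspace X)" if "continuous_map X euclideanreal f" for f :: "'a \<Rightarrow> real"
    using image_compactin[OF _ that] assms
    by (simp add: compact_space_def compact_imp_bounded)
  then show ?thesis
    by (auto simp: cfunspace_def Metric_space.fspace_def Met_TC.fspace_def)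
qed

definition isometrically_isomorphic_BC :: "'a topology \<Rightarrow> 'b topology \<Rightarrow> bool" where
  "isometrically_isomorphic_BC X Y \<longleftrightarrow>
    (\<exists>T. bij_betw T (mspace (BC X)) (mspace (BC Y)) \<and>
      (\<forall>u \<in> mspace (BC X). \<forall>v \<in> mspace (BC X).
         T (\<lambda>x \<in> topspace X. u x + v x) = (\<lambda>y \<in> topspace Y. T u y + T v y)) \<and>
      (\<forall>c. \<forall>u \<in> mspace (BC X).
         T (\<lambda>x \<in> topspace X. c * u x) = (\<lambda>y \<in> topspace Y. c * T u y)) \<and>
      (\<forall>u \<in> mspace (BC X). \<forall>v \<in> mspace (BC X).
         mdist (BC Y) (T u) (T v) = mdist (BC X) u v))"

definition eF :: "('a \<Rightarrow> real) set \<Rightarrow> 'a set \<Rightarrow> (('a \<Rightarrow> real) \<Rightarrow> real) topology" where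
  "eF F X =
    (let P = product_topology (\<lambda>f. top_of_set {(INF x\<in>X. f x)..(SUP x\<in>X. f x)}) F
     in subtopology P (P closure_of ((\<lambda>x. \<lambda>f\<in>F. f x) ` X)))"

text \<open>Functions on the product are made extensional, so that members of the family are equal
  precisely if they agree on \<open>\<Omega> \<times> ball 0 1\<close>.\<close>

definition family ::
  "(real^'n) set \<Rightarrow> (nat \<Rightarrow> real^'d \<Rightarrow> real) \<Rightarrow> ((real^'n) \<times> (real^'d) \<Rightarrow> real) set" where
  "family \<Omega> g =
    {restrict (\<lambda>(x, z). f x) (\<Omega> \<times> ball 0 1) | f. continuous_on (closure \<Omega>) f} \<union>
    {restrict (\<lambda>(x, z). h z) (\<Omega> \<times> ball 0 1) | h. continuous_on (closure (ball 0 1)) h} \<union>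
    {restrict (\<lambda>(x, z). g i z) (\<Omega> \<times> ball 0 1) | i. True}"

definition graph_pt :: "(nat \<Rightarrow> real^'d \<Rightarrow> real) \<Rightarrow> real^'d \<Rightarrow> (real^'d) \<times> (nat \<Rightarrow> real)" where
  "graph_pt g z = (z, \<lambda>i. g i z)"

definition graph_closure ::
  "(nat \<Rightarrow> real^'d \<Rightarrow> real) \<Rightarrow> ((real^'d) \<times> (nat \<Rightarrow> real)) topology" where
  "graph_closure g =
    (let P = prod_topology (top_of_set (closure (ball 0 1)))
               (product_topology (\<lambda>_. top_of_set {-1..1}) UNIV)
     in subtopology P (P closure_of (graph_pt g ` ball 0 1)))"

text \<open>
  The series are written with \<open>infsum\<close>, which is \<open>0\<close> if the terms are not summable: \<open>Metric_space\<close>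
  requires non-negativity also off the carrier, where \<open>suminf\<close> would be an unspecified real.
  On the ball and on the closure of the graph the series converge.
\<close>

definition ball_dist :: "(nat \<Rightarrow> real^'d \<Rightarrow> real) \<Rightarrow> real^'d \<Rightarrow> real^'d \<Rightarrow> real" where
  "ball_dist g z w = norm (z - w) + (\<Sum>\<^sub>\<infinity>i. \<bar>g i z - g i w\<bar> / 2 ^ i)"

definition ext_dist :: "(real^'d) \<times> (nat \<Rightarrow> real) \<Rightarrow> (real^'d) \<times> (nat \<Rightarrow> real) \<Rightarrow> real" where
  "ext_dist = (\<lambda>(z, a) (w, b). norm (z - w) + (\<Sum>\<^sub>\<infinity>i. \<bar>a i - b i\<bar> / 2 ^ i))"

end

(* Every function of the family extends continuously to the compact space
   K = closure \<Omega> \<times> closure (graph g), in which the copy of \<Omega> \<times> ball 0 1 is dense, and the extensions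
   contain all coordinate functions of K, so they separate its points. The evaluation map of the
   extensions is therefore an embedding of K whose compact image is the closure defining eF; hence
   K and eF are homeomorphic, and composition with the homeomorphism is the isometric isomorphism.
   The extended metric is a uniform limit of continuous functions, so it is continuous on the closed
   graph; its topology is Hausdorff and coarser than the compact one, and the two coincide. *)

theory Submission
  imports Defs
begin

section \<open>Spaces of bounded continuous functions under homeomorphism\<close>

lemma mspace_BC:
  "mspace (BC X) =
    {f \<in> extensional (topspace X). continuous_map X euclideanreal f \<and> bounded (f ` topspace X)}"
  by (auto simp: cfunspace_def Metric_space.fspace_def Met_TC.fspace_def)

lemma mdist_BC:
  assumes "u \<in> mspace (BC X)" "v \<in> mspace (BC X)"
  shows "mdist (BC X) u v = (if topspace X = {} then 0 else SUP x\<in>topspace X. dist (u x) (v x))"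
proof -
  have "u \<in> Met_TC.fspace (topspace X)" "v \<in> Met_TC.fspace (topspace X)"
    using assms by (auto simp: cfunspace_def)
  then show ?thesis
    by (simp add: mdist_cfunspace_eq_mdist_funspace Met_TC.fdist_def)
qed

text \<open>Composition with the inverse homeomorphism is linear and, because that inverse maps onto
  \<open>topspace X\<close>, it only reparametrises the supremum that defines the distance.\<close>

lemma homeomorphic_imp_isometrically_isomorphic_BC:
  assumes "X homeomorphic_space Y"
  shows "isometrically_isomorphic_BC X Y"
proof -
  obtain \<phi> \<psi> where "homeomorphic_maps X Y \<phi> \<psi>"
    using assms by (auto simp: homeomorphic_space_def)
  then have \<phi>: "continuous_map X Y \<phi>" and \<psi>: "continuous_map Y X \<psi>"
    and \<psi>\<phi>: "\<And>x. x \<in> topspace X \<Longrightarrow> \<psi> (\<phi> x) = x"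
    and \<phi>\<psi>: "\<And>y. y \<in> topspace Y \<Longrightarrow> \<phi> (\<psi> y) = y"
    by (auto simp: homeomorphic_maps_def)
  have \<phi>Y: "\<And>x. x \<in> topspace X \<Longrightarrow> \<phi> x \<in> topspace Y"
    and \<psi>X: "\<And>y. y \<in> topspace Y \<Longrightarrow> \<psi> y \<in> topspace X"
    using \<phi> \<psi> by (auto dest: continuous_map_funspace)
  have \<psi>_image: "\<psi> ` topspace Y = topspace X"
    using \<psi>X \<phi>Y \<psi>\<phi> by force
  \<comment> \<open>Stated for arbitrary spaces so that it serves both \<open>T\<close> and its
    inverse \<open>T'\<close>; the restriction keeps the composite extensional.\<close>
  have pullback: "(\<lambda>y\<in>topspace B. u (h y)) \<in> mspace (BC B)"
    if u: "u \<in> mspace (BC A)" and h: "continuous_map B A h"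
    for u :: "'e \<Rightarrow> real" and h :: "'f \<Rightarrow> 'e" and A B
  proof -
    have "continuous_map B euclideanreal (\<lambda>y\<in>topspace B. u (h y))"
      using u continuous_map_compose[OF h, of euclideanreal u]
      by (auto simp: mspace_BC o_def intro: continuous_map_eq)
    moreover have "(\<lambda>y\<in>topspace B. u (h y)) ` topspace B \<subseteq> u ` topspace A"
      using h by (auto dest: continuous_map_funspace)
    ultimately show ?thesis
      using u by (auto simp: mspace_BC intro: bounded_subset)
  qed
  define T where "T = (\<lambda>u::'a \<Rightarrow> real. \<lambda>y\<in>topspace Y. u (\<psi> y))"
  define T' where "T' = (\<lambda>v::'b \<Rightarrow> real. \<lambda>x\<in>topspace X. v (\<phi> x))"
  have T: "T u \<in> mspace (BC Y)" if "u \<in> mspace (BC X)" for u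
    unfolding T_def using pullback[OF that \<psi>] .
  have T': "T' v \<in> mspace (BC X)" if "v \<in> mspace (BC Y)" for v
    unfolding T'_def using pullback[OF that \<phi>] .
  have "T' (T u) = u" if "u \<in> mspace (BC X)" for u
  proof (rule extensionalityI)
    show "u \<in> extensional (topspace X)" using that by (simp add: mspace_BC)
  qed (auto simp: T_def T'_def \<phi>Y \<psi>\<phi>)
  moreover have "T (T' v) = v" if "v \<in> mspace (BC Y)" for v
  proof (rule extensionalityI)
    show "v \<in> extensional (topspace Y)" using that by (simp add: mspace_BC)
  qed (auto simp: T_def T'_def \<psi>X \<phi>\<psi>)
  ultimately have "bij_betw T (mspace (BC X)) (mspace (BC Y))"
    using T T' by (intro bij_betw_byWitness[where f' = T']) blast+
  moreover have "mdist (BC Y) (T u) (T v) = mdist (BC X) u v"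
    if "u \<in> mspace (BC X)" "v \<in> mspace (BC X)" for u v
  proof -
    have "(SUP x\<in>topspace X. dist (u x) (v x)) = (SUP y\<in>topspace Y. dist (T u y) (T v y))"
      by (simp add: T_def image_image flip: \<psi>_image)
    \<comment> \<open>On an empty carrier the distance is 0 by a separate clause of
      \<open>mdist_BC\<close>, so both carriers have to be empty together.\<close>
    moreover have "topspace X = {} \<longleftrightarrow> topspace Y = {}"
      using \<psi>_image by blast
    ultimately show ?thesis
      using that T by (simp add: mdist_BC)
  qed
  ultimately show ?thesis
    unfolding isometrically_isomorphic_BC_def
    by (intro exI[of _ T]) (auto simp: T_def \<psi>X)
qed

section \<open>Recognising \<open>eF F X\<close> among compactifications\<close>

lemma compactification_homeomorphic_eF:
  fixes K :: "'k topology" and j :: "'a \<Rightarrow> 'k" and F :: "('a \<Rightarrow> real) set"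
  assumes K: "compact_space K"
    and jK: "j ` X \<subseteq> topspace K"
    and dense: "K closure_of (j ` X) = topspace K"
    and ext: "\<And>f. f \<in> F \<Longrightarrow> \<exists>h. continuous_map K euclideanreal h \<and> (\<forall>x\<in>X. h (j x) = f x)"
    and sep: "\<And>p q. \<lbrakk>p \<in> topspace K; q \<in> topspace K; p \<noteq> q\<rbrakk> \<Longrightarrow>
      \<exists>f\<in>F. \<exists>h. continuous_map K euclideanreal h \<and> (\<forall>x\<in>X. h (j x) = f x) \<and> h p \<noteq> h q"
  shows "K homeomorphic_space eF F X"
proof -
  obtain H where H: "\<And>f. f \<in> F \<Longrightarrow> continuous_map K euclideanreal (H f)"
    and Hj: "\<And>f x. \<lbrakk>f \<in> F; x \<in> X\<rbrakk> \<Longrightarrow> H f (j x) = f x"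
    using ext by metis
  define P where "P = product_topology (\<lambda>f. top_of_set {(INF x\<in>X. f x)..(SUP x\<in>X. f x)}) F"
  define \<Phi> where "\<Phi> = (\<lambda>p. \<lambda>f\<in>F. H f p)"
  have H_range: "H f p \<in> {(INF x\<in>X. f x)..(SUP x\<in>X. f x)}" if f: "f \<in> F" and p: "p \<in> topspace K" for f p
  proof -
    have "compactin euclideanreal (H f ` topspace K)"
      using K H[OF f] image_compactin compact_space_def by blast
    then have "bounded (H f ` topspace K)"
      by (simp add: compact_imp_bounded)
    moreover have "f ` X \<subseteq> H f ` topspace K"
      using Hj[OF f] jK by force
    ultimately have "bounded (f ` X)"
      using bounded_subset by blast
    then have "H f ` j ` X \<subseteq> {(INF x\<in>X. f x)..(SUP x\<in>X. f x)}"
      using Hj[OF f] by (auto intro!: cINF_lower cSUP_upper bounded_imp_bdd_above bounded_imp_bdd_below)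
    then have "closure (H f ` j ` X) \<subseteq> {(INF x\<in>X. f x)..(SUP x\<in>X. f x)}"
      by (simp add: closure_minimal)
    moreover have "H f ` (K closure_of (j ` X)) \<subseteq> closure (H f ` j ` X)"
      using continuous_map_image_closure_subset[OF H[OF f], of "j ` X"] by simp
    ultimately show ?thesis
      using p dense by blast
  qed
  have \<Phi>: "continuous_map K P \<Phi>"
    using H H_range unfolding P_def continuous_map_componentwise
    by (auto simp: \<Phi>_def continuous_map_in_subtopology)
  have P: "Hausdorff_space P"
    unfolding P_def Hausdorff_space_product_topology
    by (simp add: Hausdorff_space_subtopology)
  have inj: "inj_on \<Phi> (topspace K)"
  proof (rule inj_onI, rule ccontr)
    fix p q assume pq: "p \<in> topspace K" "q \<in> topspace K" "\<Phi> p = \<Phi> q" "p \<noteq> q"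
    then obtain f h where f: "f \<in> F" and h: "continuous_map K euclideanreal h"
      and hj: "\<forall>x\<in>X. h (j x) = f x" and "h p \<noteq> h q"
      using sep[OF pq(1,2,4)] by blast
    \<comment> \<open>The separating extension \<open>h\<close> need not be the chosen
      \<open>H f\<close> a priori; two continuous real functions that agree on a dense set
      coincide.\<close>
    have "h r = H f r" if "r \<in> topspace K" for r
    proof (rule forall_in_closure_of_eq[OF _ _ h H[OF f]])
      show "r \<in> K closure_of (j ` X)" using that dense by simp
    qed (use hj Hj f in auto)
    moreover have "H f p = H f q"
      using fun_cong[OF pq(3), of f] f by (simp add: \<Phi>_def)
    ultimately show False
      using pq \<open>h p \<noteq> h q\<close> by simp
  qed
  have image: "(\<lambda>x. \<lambda>f\<in>F. f x) ` X = \<Phi> ` j ` X"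
    using Hj by (auto simp: \<Phi>_def image_image intro!: image_cong restrict_ext)
  \<comment> \<open>A compact image in a Hausdorff space is closed, so it contains the closure of
    the image of \<open>X\<close>; the reverse inclusion is density together with
    continuity.\<close>
  have "closedin P (\<Phi> ` topspace K)"
    using K \<Phi> P compactin_imp_closedin image_compactin compact_space_def by metis
  then have "P closure_of (\<Phi> ` j ` X) \<subseteq> \<Phi> ` topspace K"
    using jK by (intro closure_of_minimal) auto
  moreover have "\<Phi> ` topspace K \<subseteq> P closure_of (\<Phi> ` j ` X)"
    using continuous_map_image_closure_subset[OF \<Phi>, of "j ` X"] dense by simp
  ultimately have eF: "eF F X = subtopology P (\<Phi> ` topspace K)"
    unfolding eF_def Let_def P_def[symmetric] image by (simp add: subset_antisym)
  have "homeomorphic_map K (eF F X) \<Phi>"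
  proof (rule continuous_imp_homeomorphic_map[OF _ K _ _ inj])
    show "continuous_map K (eF F X) \<Phi>" "Hausdorff_space (eF F X)"
      using \<Phi> P by (auto simp: eF continuous_map_in_subtopology Hausdorff_space_subtopology)
    show "\<Phi> ` topspace K = topspace (eF F X)"
      using continuous_map_image_subset_topspace[OF \<Phi>] by (auto simp: eF)
  qed
  then show ?thesis
    by (auto simp: homeomorphic_space)
qed

section \<open>The closed graph and its metric\<close>

text \<open>The type \<open>nat \<Rightarrow> real\<close> carries the product topology, and the
  ambient space is a compact, hence closed, set \<open>C\<close> there. Closure relative to
  \<open>C\<close> is therefore ordinary closure, which permits \<open>continuous_on\<close> and
  \<open>compact\<close> in what follows.\<close>

lemma graph_closure_euclidean:
  fixes g :: "nat \<Rightarrow> real^'d \<Rightarrow> real"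
  assumes g1: "\<And>i z. z \<in> ball 0 1 \<Longrightarrow> \<bar>g i z\<bar> \<le> 1"
  defines "G \<equiv> closure (graph_pt g ` ball 0 1)"
  shows "graph_closure g = top_of_set G"
    and "compact G"
    and "G \<subseteq> closure (ball 0 1) \<times> {a. \<forall>i. \<bar>a i\<bar> \<le> 1}"
proof -
  let ?I = "\<lambda>_::nat. {-1..1::real}"
  define C where "C = closure (ball (0::real^'d) 1) \<times> PiE UNIV ?I"
  have "product_topology (\<lambda>i. top_of_set (?I i)) UNIV = top_of_set (PiE UNIV ?I)"
    by (simp add: subtopology_product_topology[symmetric] euclidean_product_topology)
  \<comment> \<open>Tychonoff's theorem for the cube.\<close>
  moreover have "compact_space (product_topology (\<lambda>i. top_of_set (?I i)) UNIV)"
    unfolding compact_space_product_topology by (simp add: compact_space_subtopology)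
  ultimately have "compact (PiE UNIV ?I)"
    and P: "prod_topology (top_of_set (closure (ball (0::real^'d) 1)))
       (product_topology (\<lambda>i. top_of_set (?I i)) UNIV) = top_of_set C"
    by (auto simp: compact_space_def compactin_subtopology C_def)
  then have C: "compact C"
    by (simp add: C_def compact_Times)
  have "graph_pt g z \<in> C" if "z \<in> ball 0 1" for z
    using g1[OF that] closure_subset that by (fastforce simp: C_def graph_pt_def abs_le_iff minus_le_iff)
  then have sub: "graph_pt g ` ball 0 1 \<subseteq> C"
    by blast
  then have GC: "G \<subseteq> C"
    unfolding G_def using C by (simp add: closure_minimal compact_imp_closed)
  then show "compact G"
    using compact_Int_closed[OF C closed_closure] by (metis G_def inf.absorb2)
  show "G \<subseteq> closure (ball 0 1) \<times> {a. \<forall>i. \<bar>a i\<bar> \<le> 1}"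
    using GC by (fastforce simp: C_def PiE_iff abs_le_iff)
  have "(top_of_set C) closure_of (graph_pt g ` ball 0 1) = G"
    using sub GC by (simp add: closure_of_subtopology inf.absorb2 G_def)
  then show "graph_closure g = top_of_set G"
    using GC unfolding graph_closure_def P Let_def by (simp add: subtopology_subtopology inf.absorb2)
qed

lemma summable_on_weighted_abs_diff:
  fixes a b :: "nat \<Rightarrow> real"
  assumes "\<And>i. \<bar>a i\<bar> \<le> 1" "\<And>i. \<bar>b i\<bar> \<le> 1"
  shows "(\<lambda>i. \<bar>a i - b i\<bar> / 2 ^ i) summable_on UNIV"
proof (rule summable_on_comparison_test)
  \<comment> \<open>The factor 2 is the diameter of the interval from -1 to 1, in which all
    coordinates lie.\<close>
  show "(\<lambda>i. 2 * (1/2) ^ i :: real) summable_on UNIV"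
    by (intro norm_summable_imp_summable_on) (auto simp: norm_power)
  show "\<bar>a i - b i\<bar> / 2 ^ i \<le> 2 * (1/2) ^ i" for i
  proof -
    have "\<bar>a i - b i\<bar> \<le> 2" using assms(1)[of i] assms(2)[of i] by linarith
    then show ?thesis by (simp add: field_simps)
  qed
qed auto

lemma Metric_space_ext_dist:
  fixes S :: "((real^'d) \<times> (nat \<Rightarrow> real)) set"
  assumes S: "S \<subseteq> UNIV \<times> {a. \<forall>i. \<bar>a i\<bar> \<le> 1}"
  shows "Metric_space S ext_dist"
proof
  \<comment> \<open>Non-negativity and symmetry are demanded for all points, also where the series
    diverges and \<open>infsum\<close> takes the value 0.\<close>
  fix p q :: "(real^'d) \<times> (nat \<Rightarrow> real)"
  show "0 \<le> ext_dist p q"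
    by (auto simp: ext_dist_def case_prod_unfold intro!: add_nonneg_nonneg infsum_nonneg)
  show "ext_dist p q = ext_dist q p"
    by (simp add: ext_dist_def case_prod_unfold norm_minus_commute abs_minus_commute)
next
  fix p q assume pq: "p \<in> S" "q \<in> S"
  obtain z a w b where [simp]: "p = (z, a)" "q = (w, b)" by fastforce
  have sm: "(\<lambda>i. \<bar>a i - b i\<bar> / 2 ^ i) summable_on UNIV"
    using pq S by (intro summable_on_weighted_abs_diff) auto
  have nn: "0 \<le> (\<Sum>\<^sub>\<infinity>i. \<bar>a i - b i\<bar> / 2 ^ i)"
    by (intro infsum_nonneg) auto
  show "ext_dist p q = 0 \<longleftrightarrow> p = q"
  proof
    assume "ext_dist p q = 0"
    then have "norm (z - w) = 0" and 0: "(\<Sum>\<^sub>\<infinity>i. \<bar>a i - b i\<bar> / 2 ^ i) = 0"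
      using nn by (simp_all add: ext_dist_def add_nonneg_eq_0_iff)
    \<comment> \<open>A summable family of non-negative terms with sum 0 vanishes termwise.\<close>
    have "\<bar>a i - b i\<bar> / 2 ^ i = 0" for i
      using nonneg_infsum_le_0D[OF _ sm, of i] 0 by simp
    then have "a = b" by (auto intro!: ext)
    then show "p = q" using \<open>norm (z - w) = 0\<close> by simp
  qed (auto simp: ext_dist_def)
next
  fix p q r assume pqr: "p \<in> S" "q \<in> S" "r \<in> S"
  obtain z a w b v c where [simp]: "p = (z, a)" "q = (w, b)" "r = (v, c)" by (metis prod.exhaust)
  have ab: "(\<lambda>i. \<bar>a i - b i\<bar> / 2 ^ i) summable_on UNIV"
    and bc: "(\<lambda>i. \<bar>b i - c i\<bar> / 2 ^ i) summable_on UNIV"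
    and ac: "(\<lambda>i. \<bar>a i - c i\<bar> / 2 ^ i) summable_on UNIV"
    using pqr S by (auto intro!: summable_on_weighted_abs_diff)
  \<comment> \<open>The triangle inequality is applied termwise; summability of all three families
    excludes the default value of \<open>infsum\<close>.\<close>
  have "(\<Sum>\<^sub>\<infinity>i. \<bar>a i - c i\<bar> / 2 ^ i) \<le> (\<Sum>\<^sub>\<infinity>i. \<bar>a i - b i\<bar> / 2 ^ i + \<bar>b i - c i\<bar> / 2 ^ i)"
    by (intro infsum_mono summable_on_add ab bc ac)
      (auto simp flip: add_divide_distrib intro!: divide_right_mono)
  also have "\<dots> = (\<Sum>\<^sub>\<infinity>i. \<bar>a i - b i\<bar> / 2 ^ i) + (\<Sum>\<^sub>\<infinity>i. \<bar>b i - c i\<bar> / 2 ^ i)"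
    by (rule infsum_add[OF ab bc])
  finally show "ext_dist p r \<le> ext_dist p q + ext_dist q r"
    using norm_triangle_ineq[of "z - w" "w - v"] by (simp add: ext_dist_def)
qed

text \<open>Each term of the series involves a single coordinate of either sequence and so is
  continuous for the product topology; the geometric majorant makes the convergence uniform.\<close>

lemma continuous_on_ext_dist:
  fixes S :: "((real^'d) \<times> (nat \<Rightarrow> real)) set"
  assumes S: "S \<subseteq> UNIV \<times> {a. \<forall>i. \<bar>a i\<bar> \<le> 1}"
  shows "continuous_on (S \<times> S) (\<lambda>(p, q). ext_dist p q)"
proof -
  define t :: "nat \<Rightarrow> ((real^'d) \<times> (nat \<Rightarrow> real)) \<times> ((real^'d) \<times> (nat \<Rightarrow> real)) \<Rightarrow> real"
    where "t = (\<lambda>i x. \<bar>snd (fst x) i - snd (snd x) i\<bar> / 2 ^ i)"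
  have "uniform_limit (S \<times> S) (\<lambda>I x. \<Sum>i\<in>I. t i x) (\<lambda>x. \<Sum>\<^sub>\<infinity>i. t i x) (finite_subsets_at_top UNIV)"
  proof (rule Weierstrass_m_test_general)
    show "norm (t i x) \<le> 2 * (1/2) ^ i" if "x \<in> S \<times> S" for i x
    proof -
      have "\<bar>snd (fst x) i\<bar> \<le> 1" "\<bar>snd (snd x) i\<bar> \<le> 1"
        using that S by auto
      then have "\<bar>snd (fst x) i - snd (snd x) i\<bar> \<le> 2" by linarith
      then show ?thesis by (simp add: t_def field_simps)
    qed
    show "(\<lambda>i. 2 * (1/2) ^ i :: real) summable_on UNIV"
      by (intro norm_summable_imp_summable_on) (auto simp: norm_power)
  qed
  moreover have "continuous_on (S \<times> S) (t i)" for i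
    unfolding t_def
    by (intro continuous_intros continuous_on_product_then_coordinatewise) auto
  ultimately have "continuous_on (S \<times> S) (\<lambda>x. \<Sum>\<^sub>\<infinity>i. t i x)"
    by (intro uniform_limit_theorem[where f = "\<lambda>I x. \<Sum>i\<in>I. t i x" and F = "finite_subsets_at_top UNIV"])
      (auto intro!: always_eventually continuous_on_sum)
  then show ?thesis
    unfolding ext_dist_def case_prod_unfold t_def
    by (intro continuous_intros)
qed

text \<open>Continuity of \<open>d\<close> in its second argument makes balls open in
  \<open>X\<close>, so \<open>mtopology\<close> is coarser than \<open>X\<close>. A compact topology
  has no strictly coarser Hausdorff topology on the same carrier.\<close>

lemma (in Metric_space) mtopology_eq_compact_topology:
  assumes X: "compact_space X" "topspace X = M"
    and d: "continuous_map (prod_topology X X) euclideanreal (\<lambda>(x, y). d x y)"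
  shows "mtopology = X"
proof (rule compact_Hausdorff_space_optimal[symmetric])
  fix U assume U: "openin mtopology U"
  show "openin X U"
  proof (subst openin_subopen, intro ballI)
    fix x assume "x \<in> U"
    then obtain r where "r > 0" "mball x r \<subseteq> U" and xM: "x \<in> M"
      using U by (meson openin_mtopology subsetD)
    have "continuous_map X (prod_topology X X) (\<lambda>y. (x, y))"
      using xM X by (simp add: continuous_map_pairedI)
    then have "continuous_map X euclideanreal (\<lambda>y. d x y)"
      using continuous_map_compose[OF _ d] by (fastforce simp: o_def)
    then have "openin X {y \<in> topspace X. d x y \<in> {..<r}}"
      by (rule openin_continuous_map_preimage) auto
    moreover have "{y \<in> topspace X. d x y \<in> {..<r}} = mball x r"
      using xM X(2) by (auto simp: mball_def)
    ultimately show "\<exists>T. openin X T \<and> x \<in> T \<and> T \<subseteq> U"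
      using \<open>r > 0\<close> \<open>mball x r \<subseteq> U\<close> xM by (metis centre_in_mball_iff)
  qed
qed (use X Hausdorff_space_mtopology in auto)

section \<open>The product of \<open>closure \<Omega>\<close> with the closed graph\<close>

theorem lemma2p16:
  fixes \<Omega> :: "(real^'n) set" and g :: "nat \<Rightarrow> real^'d \<Rightarrow> real"
  assumes "open \<Omega>" and "bounded \<Omega>"
    and "\<And>i. continuous_on (ball 0 1) (g i)"
    and "\<And>i. bounded (g i ` ball 0 1)"
    and "\<And>i. (SUP z\<in>ball 0 1. \<bar>g i z\<bar>) \<le> 1"
  shows "isometrically_isomorphic_BC
           (eF (family \<Omega> g) (\<Omega> \<times> ball 0 1))
           (prod_topology (top_of_set (closure \<Omega>)) (graph_closure g)) \<and>
         (\<forall>z \<in> ball 0 1. \<forall>w \<in> ball 0 1. ext_dist (graph_pt g z) (graph_pt g w) = ball_dist g z w) \<and>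
         continuous_map (prod_topology (graph_closure g) (graph_closure g)) euclideanreal
           (\<lambda>(p, q). ext_dist p q) \<and>
         Metric_space (topspace (graph_closure g)) ext_dist \<and>
         Metric_space.mtopology (topspace (graph_closure g)) ext_dist = graph_closure g"
proof -
  define G where "G = closure (graph_pt g ` ball 0 1)"
  have g1: "\<bar>g i z\<bar> \<le> 1" if "z \<in> ball 0 1" for i z
  proof -
    \<comment> \<open>A real supremum bounds the values only if they are bounded above, which comes
      from the boundedness of \<open>g i\<close>.\<close>
    have "bdd_above ((\<lambda>z. \<bar>g i z\<bar>) ` ball 0 1)"
      using assms(4)[of i] by (auto simp: bounded_iff bdd_above_def)
    then show ?thesis
      using cSUP_upper[OF that] assms(5)[of i] by fastforce
  qed
  have G: "graph_closure g = top_of_set G" "compact G"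
    "G \<subseteq> closure (ball 0 1) \<times> {a. \<forall>i. \<bar>a i\<bar> \<le> 1}"
    unfolding G_def by (rule graph_closure_euclidean, erule g1)+
  have GC: "fst q \<in> closure (ball 0 1)" if "q \<in> G" for q
    using G(3) that by auto
  have GU: "G \<subseteq> UNIV \<times> {a. \<forall>i. \<bar>a i\<bar> \<le> 1}"
    using G(3) by auto
  have top: "topspace (graph_closure g) = G"
    by (simp add: G(1))
  have d: "continuous_map (prod_topology (graph_closure g) (graph_closure g)) euclideanreal
      (\<lambda>(p, q). ext_dist p q)"
    using continuous_on_ext_dist[OF GU] by (simp add: G(1))
  have M: "Metric_space G ext_dist"
    using Metric_space_ext_dist[OF GU] .
  have "compact_space (graph_closure g)"
    by (simp add: G(1,2) compact_space_subtopology)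
  then have mtop: "Metric_space.mtopology G ext_dist = graph_closure g"
    using Metric_space.mtopology_eq_compact_topology[OF M _ top d] by simp

  define X where "X = \<Omega> \<times> ball (0::real^'d) 1"
  define K where "K = closure \<Omega> \<times> G"
  \<comment> \<open>The embedding lifts \<open>z\<close> to the graph point above it and leaves
    \<open>x\<close> fixed.\<close>
  define j where "j = (\<lambda>(x::real^'n, z). (x, graph_pt g z))"
  have K: "prod_topology (top_of_set (closure \<Omega>)) (graph_closure g) = top_of_set K"
    by (simp add: G(1) K_def)
  have jX: "j ` X = \<Omega> \<times> graph_pt g ` ball 0 1"
    by (force simp: j_def X_def)
  have F1: "restrict (\<lambda>(x, z). f x) X \<in> family \<Omega> g" if "continuous_on (closure \<Omega>) f" for f
    using that by (auto simp: family_def X_def)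
  have F2: "restrict (\<lambda>(x, z). h z) X \<in> family \<Omega> g" if "continuous_on (closure (ball 0 1)) h" for h
    using that by (auto simp: family_def X_def)
  have F3: "restrict (\<lambda>(x, z). g i z) X \<in> family \<Omega> g" for i
    by (auto simp: family_def X_def)
  \<comment> \<open>The extensions to \<open>K\<close>: functions of \<open>x\<close> or of
    \<open>z\<close> are composed with the projections, while \<open>g i\<close> becomes the i-th
    coordinate of the sequence component.\<close>
  have c1: "continuous_on K (\<lambda>p. f (fst p))" if "continuous_on (closure \<Omega>) f" for f :: "real^'n \<Rightarrow> real"
    by (rule continuous_on_compose2[OF that]) (auto simp: K_def intro!: continuous_intros)
  have c2: "continuous_on K (\<lambda>p. h (fst (snd p)))" if "continuous_on (closure (ball 0 1)) h"
    for h :: "real^'d \<Rightarrow> real"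
    by (rule continuous_on_compose2[OF that]) (use GC in \<open>force simp: K_def intro!: continuous_intros\<close>)+
  have c3: "continuous_on K (\<lambda>p. snd (snd p) i)" for i
    by (rule continuous_on_product_then_coordinatewise[where f = "\<lambda>p. snd (snd p)"])
      (intro continuous_on_snd continuous_on_id)
  have "top_of_set K homeomorphic_space eF (family \<Omega> g) X"
  proof (rule compactification_homeomorphic_eF)
    show "compact_space (top_of_set K)"
      using \<open>bounded \<Omega>\<close> G(2) by (simp add: K_def compact_space_subtopology compact_Times)
    show "j ` X \<subseteq> topspace (top_of_set K)"
      unfolding jX K_def G_def topspace_euclidean_subtopology by (intro Sigma_mono closure_subset)
    \<comment> \<open>Density follows because the closure of a product is the product of the
      closures.\<close>
    then have "K \<inter> j ` X = j ` X" by auto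
    then show "top_of_set K closure_of (j ` X) = topspace (top_of_set K)"
      by (simp add: closure_of_subtopology jX closure_Times K_def G_def)
  next
    fix f assume "f \<in> family \<Omega> g"
    then consider (base) f' where "f = restrict (\<lambda>(x, z). f' x) X" "continuous_on (closure \<Omega>) f'"
      | (fibre) h where "f = restrict (\<lambda>(x, z). h z) X" "continuous_on (closure (ball 0 1)) h"
      | (coordinate) i where "f = restrict (\<lambda>(x, z). g i z) X"
      unfolding family_def X_def by blast
    then show "\<exists>h. continuous_map (top_of_set K) euclideanreal h \<and> (\<forall>x\<in>X. h (j x) = f x)"
    proof cases
      case base
      then show ?thesis
        by (intro exI[of _ "\<lambda>p. f' (fst p)"]) (auto simp: c1 j_def)
    next
      case fibre
      then show ?thesis
        by (intro exI[of _ "\<lambda>p. h (fst (snd p))"]) (auto simp: c2 j_def graph_pt_def)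
    next
      case coordinate
      then show ?thesis
        by (intro exI[of _ "\<lambda>p. snd (snd p) i"]) (auto simp: c3 j_def graph_pt_def)
    qed
  next
    fix p q :: "(real^'n) \<times> (real^'d) \<times> (nat \<Rightarrow> real)" assume "p \<noteq> q"
    \<comment> \<open>Distinct points differ in a Euclidean coordinate of \<open>x\<close> or of
      \<open>z\<close>, or in an entry of the sequence. The coordinate functions belong to the two
      spaces of continuous functions in the family; the last case, such as two points above the same
      boundary point of the ball, is separated by the extension of some \<open>g i\<close>.\<close>
    then consider (base) k where "fst p $ k \<noteq> fst q $ k"
      | (fibre) k where "fst (snd p) $ k \<noteq> fst (snd q) $ k"
      | (coordinate) i where "snd (snd p) i \<noteq> snd (snd q) i"
      by (auto simp: prod_eq_iff vec_eq_iff fun_eq_iff)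
    then show "\<exists>f\<in>family \<Omega> g. \<exists>h. continuous_map (top_of_set K) euclideanreal h \<and>
        (\<forall>x\<in>X. h (j x) = f x) \<and> h p \<noteq> h q"
    proof cases
      case base
      have "continuous_on (closure \<Omega>) (\<lambda>x. x $ k)" by (intro continuous_intros)
      from F1[OF this] c1[OF this] base show ?thesis
        by (intro bexI exI[of _ "\<lambda>p. fst p $ k"]) (auto simp: j_def)
    next
      case fibre
      have "continuous_on (closure (ball 0 1)) (\<lambda>z::real^'d. z $ k)" by (intro continuous_intros)
      from F2[OF this] c2[OF this] fibre show ?thesis
        by (intro bexI exI[of _ "\<lambda>p. fst (snd p) $ k"]) (auto simp: j_def graph_pt_def)
    next
      case coordinate
      with F3[of i] c3[of i] show ?thesis
        by (intro bexI exI[of _ "\<lambda>p. snd (snd p) i"]) (auto simp: j_def graph_pt_def)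
    qed
  qed
  then have "isometrically_isomorphic_BC (eF (family \<Omega> g) (\<Omega> \<times> ball 0 1))
      (prod_topology (top_of_set (closure \<Omega>)) (graph_closure g))"
    unfolding K X_def
    by (intro homeomorphic_imp_isometrically_isomorphic_BC) (rule homeomorphic_space_sym[THEN iffD1])
  \<comment> \<open>That \<open>ext_dist\<close> extends \<open>ball_dist\<close> is seen by
    unfolding at graph points.\<close>
  then show ?thesis
    using d M mtop by (simp add: top ext_dist_def graph_pt_def ball_dist_def)
qed

end
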